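(* Let $\mathscr{A}=(\mathscr{A},f,g)$ be a commutative Krasner $(m,n)$-hyperring with scalar identity $1_{\mathscr{A}}$, let $Q_1,\dots,Q_k$ ($k\ge 1$) be finitely many minimal $n$-ary prime hyperideals of $\mathscr{A}$, and let $S=\mathscr{A}\setminus\bigcup_{j=1}^k Q_j$. If $P$ is an $n$-ary $S$-hyperideal of $\mathscr{A}$, then $P=\bigcap_{j=1}^k P_j$, where $P_j=\{x\in\mathscr{A}\mid g(t_j,x,1_{\mathscr{A}}^{(n-2)})\in P\text{ for some }t_j\in\mathscr{A}\setminus Q_j\}$ for each $1\le j\le k$.
   Context: Let $m,n\ge 2$. Notation: $p_i^j$ denotes the sequence $p_i,\dots,p_j$ (empty if $j<i$); $p^{(k)}$ denotes $p$ repeated $k$ times; for non-empty subsets, $f(P_1^m)=\bigcup\{f(p_1^m)\mid p_i\in P_i\}$ and similarly for $g$; singletons are identified with elements. A canonical $m$-ary hypergroup $(\mathscr{A},f)$ is a set with $f:\mathscr{A}^m\to\{\text{non-empty subsets of }\mathscr{A}\}$ such that: $f$ is associative ($f(p_1^{i-1},f(p_i^{m+i-1}),p_{m+i}^{2m-1})$ is independent of $i$) and invariant under permutations of its arguments; there is a unique $0$ with $f(p,0^{(m-1)})=\{p\}$ for all $p$; each $p$ has a unique $-p$ with $0\in f(p,-p,0^{(m-2)})$; and $p\in f(p_1^m)$ implies $p_i\in f(p,-p_1,\dots,-p_{i-1},-p_{i+1},\dots,-p_m)$ for each $i$. A commutative Krasner $(m,n)$-hyperring with scalar identity $1_{\mathscr{A}}$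 is $(\mathscr{A},f,g)$ with $(\mathscr{A},f)$ a canonical $m$-ary hypergroup, $g:\mathscr{A}^n\to\mathscr{A}$ an associative operation invariant under permutations of its arguments, $g$ distributive over $f$ in each argument ($g(p_1^{i-1},f(q_1^m),p_{i+1}^n)=f(g(p_1^{i-1},q_1,p_{i+1}^n),\dots,g(p_1^{i-1},q_m,p_{i+1}^n))$), $g(0,p_2^n)=0$, and $g(p,1_{\mathscr{A}}^{(n-1)})=p$ for all $p$. A hyperideal is a non-empty $P\subseteq\mathscr{A}$ with $f(p_1^m)\subseteq P$ and $-p\in P$ for all $p,p_1,\dots,p_m\in P$, and $g(p_1^{i-1},P,p_{i+1}^n)\subseteq P$ for all $p_j\in\mathscr{A}$ and all $i$; it is proper if $P\ne\mathscr{A}$. A proper hyperideal $P$ is $n$-ary prime if $g(p_1^n)\in P$ implies $p_i\in P$ for some $i$; a minimal $n$-ary prime hyperideal is one minimal under inclusion among all $n$-ary prime hyperideals of $\mathscr{A}$. An $n$-ary multiplicative subset is a non-empty $S\subseteq\mathscr{A}$ with $g(s_1^n)\in S$ for all $s_1,\dots,s_n\in S$ (e.g. the complement of a union of $n$-ary prime hyperideals). Given such $S$, an $n$-ary $S$-hyperideal is a proper hyperideal $P$ such that whenever $g(p_1^n)\in P$ with $p_1,\dots,p_n\in\mathscr{A}$ and $p_i\in S$ for some $i$, then $g(p_1^{i-1},1_{\mathscr{A}},p_{i+1}^n)\in P$. *)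

theory Defs
  imports Complex_Main "HOL-Library.Multiset" "HOL-Library.NList"
begin

text \<open>An \<open>m\<close>-ary (hyper)operation on a set \<open>A\<close> is a function on lists, constrained only on
  \<^term>\<open>nlists m A\<close>, the lists of length \<open>m\<close> over \<open>A\<close>. Positions are counted from \<open>0\<close>.\<close>

definition hyper_ext :: "('a list \<Rightarrow> 'a set) \<Rightarrow> 'a set list \<Rightarrow> 'a set" where
  "hyper_ext f Ps = \<Union> (f ` listset Ps)"

definition singles :: "'a list \<Rightarrow> 'a set list" where
  "singles xs = map (\<lambda>x. {x}) xs"

definition is_hyper_zero :: "nat \<Rightarrow> 'a set \<Rightarrow> ('a list \<Rightarrow> 'a set) \<Rightarrow> 'a \<Rightarrow> bool" where
  "is_hyper_zero m A f z \<longleftrightarrow> z \<in> A \<and> (\<forall>p\<in>A. f (p # replicate (m - 1) z) = {p})"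

definition hyper_zero :: "nat \<Rightarrow> 'a set \<Rightarrow> ('a list \<Rightarrow> 'a set) \<Rightarrow> 'a" where
  "hyper_zero m A f = (THE z. is_hyper_zero m A f z)"

definition is_hyper_neg :: "nat \<Rightarrow> 'a set \<Rightarrow> ('a list \<Rightarrow> 'a set) \<Rightarrow> 'a \<Rightarrow> 'a \<Rightarrow> bool" where
  "is_hyper_neg m A f p q \<longleftrightarrow>
     q \<in> A \<and> hyper_zero m A f \<in> f (p # q # replicate (m - 2) (hyper_zero m A f))"

definition hyper_neg :: "nat \<Rightarrow> 'a set \<Rightarrow> ('a list \<Rightarrow> 'a set) \<Rightarrow> 'a \<Rightarrow> 'a" where
  "hyper_neg m A f p = (THE q. is_hyper_neg m A f p q)"

locale canonical_hypergroup =
  fixes m :: nat and A :: "'a set" and f :: "'a list \<Rightarrow> 'a set"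
  assumes m_ge_2: "m \<ge> 2"
    and f_closed: "xs \<in> nlists m A \<Longrightarrow> f xs \<noteq> {} \<and> f xs \<subseteq> A"
    and f_assoc: "\<lbrakk>xs \<in> nlists (2 * m - 1) A; i < m; j < m\<rbrakk> \<Longrightarrow>
      hyper_ext f (singles (take i xs) @ [f (take m (drop i xs))] @ singles (drop (i + m) xs)) =
      hyper_ext f (singles (take j xs) @ [f (take m (drop j xs))] @ singles (drop (j + m) xs))"
    and f_perm: "\<lbrakk>xs \<in> nlists m A; ys \<in> nlists m A; mset xs = mset ys\<rbrakk> \<Longrightarrow> f xs = f ys"
    and ex1_zero: "\<exists>!z. is_hyper_zero m A f z"
    and ex1_neg: "p \<in> A \<Longrightarrow> \<exists>!q. is_hyper_neg m A f p q"
    and f_reversible: "\<lbrakk>xs \<in> nlists m A; p \<in> f xs; i < m\<rbrakk> \<Longrightarrow>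
      xs ! i \<in> f (p # map (hyper_neg m A f) (take i xs @ drop (Suc i) xs))"

locale comm_krasner_hyperring = canonical_hypergroup m A f
  for m n :: nat and A :: "'a set" and f :: "'a list \<Rightarrow> 'a set"
    and g :: "'a list \<Rightarrow> 'a" and e :: 'a +
  assumes n_ge_2: "n \<ge> 2"
    and g_closed: "xs \<in> nlists n A \<Longrightarrow> g xs \<in> A"
    and g_assoc: "\<lbrakk>xs \<in> nlists (2 * n - 1) A; i < n; j < n\<rbrakk> \<Longrightarrow>
      g (take i xs @ [g (take n (drop i xs))] @ drop (i + n) xs) =
      g (take j xs @ [g (take n (drop j xs))] @ drop (j + n) xs)"
    and g_perm: "\<lbrakk>xs \<in> nlists n A; ys \<in> nlists n A; mset xs = mset ys\<rbrakk> \<Longrightarrow> g xs = g ys"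
    and g_distrib: "\<lbrakk>xs \<in> nlists n A; ys \<in> nlists m A; i < n\<rbrakk> \<Longrightarrow>
      (\<lambda>q. g (xs[i := q])) ` f ys = f (map (\<lambda>q. g (xs[i := q])) ys)"
    and g_zero: "xs \<in> nlists (n - 1) A \<Longrightarrow> g (hyper_zero m A f # xs) = hyper_zero m A f"
    and one_closed: "e \<in> A"
    and g_one: "p \<in> A \<Longrightarrow> g (p # replicate (n - 1) e) = p"

definition hyperideal ::
    "nat \<Rightarrow> nat \<Rightarrow> 'a set \<Rightarrow> ('a list \<Rightarrow> 'a set) \<Rightarrow> ('a list \<Rightarrow> 'a) \<Rightarrow> 'a set \<Rightarrow> bool" where
  "hyperideal m n A f g P \<longleftrightarrow>
     P \<noteq> {} \<and> P \<subseteq> A \<and>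
     (\<forall>ps \<in> nlists m P. f ps \<subseteq> P) \<and>
     (\<forall>p\<in>P. hyper_neg m A f p \<in> P) \<and>
     (\<forall>xs \<in> nlists n A. \<forall>i<n. \<forall>p\<in>P. g (xs[i := p]) \<in> P)"

definition proper_hyperideal ::
    "nat \<Rightarrow> nat \<Rightarrow> 'a set \<Rightarrow> ('a list \<Rightarrow> 'a set) \<Rightarrow> ('a list \<Rightarrow> 'a) \<Rightarrow> 'a set \<Rightarrow> bool" where
  "proper_hyperideal m n A f g P \<longleftrightarrow> hyperideal m n A f g P \<and> P \<noteq> A"

definition prime_hyperideal ::
    "nat \<Rightarrow> nat \<Rightarrow> 'a set \<Rightarrow> ('a list \<Rightarrow> 'a set) \<Rightarrow> ('a list \<Rightarrow> 'a) \<Rightarrow> 'a set \<Rightarrow> bool" where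
  "prime_hyperideal m n A f g P \<longleftrightarrow>
     proper_hyperideal m n A f g P \<and>
     (\<forall>xs \<in> nlists n A. g xs \<in> P \<longrightarrow> (\<exists>i<n. xs ! i \<in> P))"

definition minimal_prime_hyperideal ::
    "nat \<Rightarrow> nat \<Rightarrow> 'a set \<Rightarrow> ('a list \<Rightarrow> 'a set) \<Rightarrow> ('a list \<Rightarrow> 'a) \<Rightarrow> 'a set \<Rightarrow> bool" where
  "minimal_prime_hyperideal m n A f g P \<longleftrightarrow>
     prime_hyperideal m n A f g P \<and>
     (\<forall>Q. prime_hyperideal m n A f g Q \<and> Q \<subseteq> P \<longrightarrow> Q = P)"

definition multiplicative_subset :: "nat \<Rightarrow> 'a set \<Rightarrow> ('a list \<Rightarrow> 'a) \<Rightarrow> 'a set \<Rightarrow> bool" where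
  "multiplicative_subset n A g S \<longleftrightarrow> S \<noteq> {} \<and> S \<subseteq> A \<and> (\<forall>ss \<in> nlists n S. g ss \<in> S)"

text \<open>The set \<open>S\<close> is meant to be an \<open>n\<close>-ary multiplicative subset. This is not part of the
  definition; complements of unions of prime hyperideals satisfy it by the lemma below.\<close>

definition S_hyperideal ::
    "nat \<Rightarrow> nat \<Rightarrow> 'a set \<Rightarrow> ('a list \<Rightarrow> 'a set) \<Rightarrow> ('a list \<Rightarrow> 'a) \<Rightarrow> 'a \<Rightarrow> 'a set \<Rightarrow> 'a set \<Rightarrow> bool" where
  "S_hyperideal m n A f g e S P \<longleftrightarrow>
     proper_hyperideal m n A f g P \<and>
     (\<forall>xs \<in> nlists n A. \<forall>i<n. g xs \<in> P \<and> xs ! i \<in> S \<longrightarrow> g (xs[i := e]) \<in> P)"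

lemma (in comm_krasner_hyperring) one_notin_proper:
  assumes "proper_hyperideal m n A f g P"
  shows "e \<notin> P"
proof
  assume e: "e \<in> P"
  obtain l where l: "n - 1 = Suc l"
    using n_ge_2 by (cases "n - 1") simp_all
  have absorb: "\<forall>xs \<in> nlists n A. \<forall>i<n. \<forall>p\<in>P. g (xs[i := p]) \<in> P"
    and "P \<subseteq> A" "P \<noteq> A"
    using assms unfolding proper_hyperideal_def hyperideal_def by auto
  have "x \<in> P" if x: "x \<in> A" for x
  proof -
    let ?xs = "x # e # replicate l e"
    have "length ?xs = n"
      using n_ge_2 l by simp
    moreover have "set ?xs \<subseteq> A"
      using x one_closed by (simp add: set_replicate_conv_if)
    ultimately have "?xs \<in> nlists n A"
      by (rule nlistsI)
    then have "g (?xs[1 := e]) \<in> P"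
      using absorb e n_ge_2 by (metis Suc_1 Suc_le_lessD)
    then show ?thesis
      using g_one[OF x, unfolded l] by simp
  qed
  then have "A \<subseteq> P"
    by (rule subsetI)
  with \<open>P \<subseteq> A\<close> \<open>P \<noteq> A\<close> show False
    by simp
qed

lemma (in comm_krasner_hyperring) multiplicative_subset_complement_primes:
  assumes "\<And>j. j \<in> J \<Longrightarrow> prime_hyperideal m n A f g (Q j)"
  shows "multiplicative_subset n A g (A - (\<Union>j\<in>J. Q j))"
proof -
  define S where "S = A - (\<Union>j\<in>J. Q j)"
  have "e \<notin> Q j" if "j \<in> J" for j
    using assms[OF that] one_notin_proper unfolding prime_hyperideal_def by simp
  then have "e \<in> S"
    using one_closed by (simp add: S_def)
  moreover have "S \<subseteq> A"
    unfolding S_def by (rule Diff_subset)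
  moreover have "g ss \<in> S" if ss: "ss \<in> nlists n S" for ss
  proof -
    have ssA: "ss \<in> nlists n A"
      using nlists_mono[OF \<open>S \<subseteq> A\<close>] ss by (rule subsetD)
    have "g ss \<notin> Q j" if j: "j \<in> J" for j
    proof
      assume "g ss \<in> Q j"
      then obtain i where i: "i < n" "ss ! i \<in> Q j"
        using assms[OF j] ssA unfolding prime_hyperideal_def by auto
      have "ss ! i \<in> set ss"
        using ss i(1) by simp
      then have "ss ! i \<in> S"
        using nlistsE_set[OF ss] by (rule subsetD[rotated])
      then show False
        using i(2) j by (simp add: S_def)
    qed
    with g_closed[OF ssA] show ?thesis
      by (simp add: S_def)
  qed
  ultimately have "multiplicative_subset n A g S"
    unfolding multiplicative_subset_def by auto
  then show ?thesis
    by (simp only: S_def)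
qed

end

theory Submission
  imports Defs
begin

text \<open>For \<open>x\<close> in the intersection of the \<open>P\<^sub>j\<close>, the residual \<open>(P : x)\<close> is a hyperideal contained in no
  \<open>Q\<^sub>j\<close>. By prime avoidance it is not contained in the union of the \<open>Q\<^sub>j\<close>, so it meets \<open>S\<close>, and
  the \<open>S\<close>-hyperideal condition cancels an element of \<open>S\<close> from its product with \<open>x\<close>. Prime
  avoidance holds as in rings: reversibility of the hyperaddition replaces subtraction.\<close>

section \<open>Zero, negatives and binary sums in a canonical hypergroup\<close>

context canonical_hypergroup
begin

abbreviation zero :: 'a where "zero \<equiv> hyper_zero m A f"

abbreviation neg :: "'a \<Rightarrow> 'a" where "neg \<equiv> hyper_neg m A f"

text \<open>Padding with \<open>zero\<close> reduces the \<open>m\<close>-ary hyperaddition to a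
  binary one, which is all that prime avoidance works with.\<close>

definition hadd :: "'a \<Rightarrow> 'a \<Rightarrow> 'a set" where
  "hadd x y = f (x # y # replicate (m - 2) zero)"

lemma zero_closed: "zero \<in> A"
  using theI'[OF ex1_zero] unfolding hyper_zero_def is_hyper_zero_def by simp

lemma is_hyper_neg_neg: "p \<in> A \<Longrightarrow> is_hyper_neg m A f p (neg p)"
  using theI'[OF ex1_neg] unfolding hyper_neg_def by simp

lemma neg_closed: "p \<in> A \<Longrightarrow> neg p \<in> A"
  using is_hyper_neg_neg unfolding is_hyper_neg_def by simp

lemma zero_in_hadd_neg: "p \<in> A \<Longrightarrow> zero \<in> hadd p (neg p)"
  using is_hyper_neg_neg unfolding is_hyper_neg_def hadd_def by simp

lemma neg_unique: "\<lbrakk>p \<in> A; q \<in> A; zero \<in> hadd p q\<rbrakk> \<Longrightarrow> neg p = q"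
  using ex1_neg is_hyper_neg_neg unfolding is_hyper_neg_def hadd_def by blast

lemma hadd_list_in_nlists:
  assumes "x \<in> B" "y \<in> B" "z \<in> B"
  shows "x # y # replicate (m - 2) z \<in> nlists m B"
  using assms m_ge_2 by (auto intro!: nlistsI simp: set_replicate_conv_if split: if_splits)

lemma hadd_nonempty: "\<lbrakk>x \<in> A; y \<in> A\<rbrakk> \<Longrightarrow> hadd x y \<noteq> {}"
  using f_closed[OF hadd_list_in_nlists] zero_closed unfolding hadd_def by simp

end

section \<open>The binary product and its laws\<close>

context comm_krasner_hyperring
begin

text \<open>The product that occurs in the sets \<open>P\<^sub>j\<close>, with the scalar identity
  as padding.\<close>

definition mul :: "'a \<Rightarrow> 'a \<Rightarrow> 'a" where
  "mul x y = g (x # y # replicate (n - 2) e)"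

lemma mul_list_in_nlists:
  assumes "x \<in> A" "y \<in> A"
  shows "x # y # replicate (n - 2) e \<in> nlists n A"
  using assms n_ge_2 one_closed by (auto intro!: nlistsI simp: set_replicate_conv_if split: if_splits)

lemma mul_closed: "\<lbrakk>x \<in> A; y \<in> A\<rbrakk> \<Longrightarrow> mul x y \<in> A"
  unfolding mul_def by (intro g_closed mul_list_in_nlists)

lemma mul_one_left:
  assumes "x \<in> A"
  shows "mul e x = x"
proof -
  have eq: "x # e # replicate (n - 2) e = x # replicate (n - 1) e"
    using n_ge_2 by (simp add: Suc_diff_Suc numeral_2_eq_2 flip: replicate_Suc)
  have "mul e x = g (x # e # replicate (n - 2) e)"
    unfolding mul_def using assms one_closed
    by (intro g_perm mul_list_in_nlists) simp_all
  then show ?thesis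
    using g_one[OF assms] eq by simp
qed

lemma mul_zero_left:
  assumes "x \<in> A"
  shows "mul zero x = zero"
  unfolding mul_def using assms n_ge_2 one_closed
  by (intro g_zero) (auto intro!: nlistsI simp: set_replicate_conv_if split: if_splits)

lemma mul_image_f:
  assumes "x \<in> A" "ys \<in> nlists m A"
  shows "(\<lambda>q. mul q x) ` f ys = f (map (\<lambda>q. mul q x) ys)"
  \<comment> \<open>The \<open>e\<close> in slot 0 is a placeholder that the list update
    overwrites.\<close>
  using g_distrib[OF mul_list_in_nlists[OF one_closed assms(1)] assms(2), of 0] n_ge_2
  by (simp add: mul_def)

text \<open>Multiplying \<open>zero \<in> hadd y (neg y)\<close> by \<open>x\<close> and
  distributing puts \<open>zero\<close> into the sum of the two products; uniqueness of negatives
  does the rest.\<close>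

lemma mul_neg_left:
  assumes "x \<in> A" "y \<in> A"
  shows "mul (neg y) x = neg (mul y x)"
proof -
  have "mul zero x \<in> (\<lambda>q. mul q x) ` hadd y (neg y)"
    using zero_in_hadd_neg[OF assms(2)] by (rule imageI)
  also have "\<dots> = hadd (mul y x) (mul (neg y) x)"
    using mul_image_f[OF assms(1) hadd_list_in_nlists[OF assms(2) neg_closed[OF assms(2)] zero_closed]]
      mul_zero_left[OF assms(1)]
    by (simp add: hadd_def)
  finally have "zero \<in> hadd (mul y x) (mul (neg y) x)"
    using mul_zero_left[OF assms(1)] by simp
  then show ?thesis
    using neg_unique assms mul_closed neg_closed by metis
qed

lemma mul_g_snoc:
  assumes "xs \<in> nlists (n - 1) A" "y \<in> A" "x \<in> A"
  shows "mul (g (xs @ [y])) x = g (xs @ [mul y x])"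
proof -
  let ?zs = "xs @ y # x # replicate (n - 2) e"
  have len: "length xs = n - 1"
    using assms(1) by simp
  have "?zs \<in> nlists (2 * n - 1) A"
    using len assms(2,3) nlistsE_set[OF assms(1)] one_closed n_ge_2
    by (auto intro!: nlistsI simp: set_replicate_conv_if split: if_splits)
  \<comment> \<open>Bracketing the first \<open>n\<close> entries gives the left side; bracketing
    the last \<open>n\<close> gives \<open>mul y x\<close> in the last slot.\<close>
  from g_assoc[OF this, of 0 "n - 1"] show ?thesis
    using len n_ge_2 by (simp add: mul_def take_Cons' drop_Cons' numeral_2_eq_2)
qed

section \<open>Hyperideals under the binary operations\<close>

lemma hyperideal_subset: "hyperideal m n A f g I \<Longrightarrow> I \<subseteq> A"
  unfolding hyperideal_def by simp

lemma hyperideal_f: "\<lbrakk>hyperideal m n A f g I; ps \<in> nlists m I\<rbrakk> \<Longrightarrow> f ps \<subseteq> I"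
  unfolding hyperideal_def by simp

lemma hyperideal_neg: "\<lbrakk>hyperideal m n A f g I; p \<in> I\<rbrakk> \<Longrightarrow> neg p \<in> I"
  unfolding hyperideal_def by simp

lemma hyperideal_g:
  "\<lbrakk>hyperideal m n A f g I; xs \<in> nlists n A; i < n; p \<in> I\<rbrakk> \<Longrightarrow> g (xs[i := p]) \<in> I"
  unfolding hyperideal_def by simp

lemma hyperideal_mul_left:
  assumes "hyperideal m n A f g I" "x \<in> A" "y \<in> I"
  shows "mul x y \<in> I"
  using hyperideal_g[OF assms(1) mul_list_in_nlists[OF assms(2) one_closed], of 1 y] assms(3) n_ge_2
  by (simp add: mul_def)

lemma hyperideal_mul_right:
  assumes "hyperideal m n A f g I" "x \<in> I" "y \<in> A"
  shows "mul x y \<in> I"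
  using hyperideal_g[OF assms(1) mul_list_in_nlists[OF one_closed assms(3)], of 0 x] assms(2) n_ge_2
  by (simp add: mul_def)

lemma hyperideal_zero:
  assumes "hyperideal m n A f g I"
  shows "zero \<in> I"
proof -
  obtain p where "p \<in> I"
    using assms unfolding hyperideal_def by auto
  then show ?thesis
    using hyperideal_mul_left[OF assms zero_closed, of p] mul_zero_left hyperideal_subset[OF assms]
    by auto
qed

lemma hyperideal_hadd:
  assumes "hyperideal m n A f g I" "x \<in> I" "y \<in> I"
  shows "hadd x y \<subseteq> I"
  unfolding hadd_def
  using assms hyperideal_zero by (intro hyperideal_f hadd_list_in_nlists) simp_all

lemma hyperideal_hadd_cancel_left:
  assumes I: "hyperideal m n A f g I" and "x \<in> I" "y \<in> A" "w \<in> I" "w \<in> hadd x y"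
  shows "y \<in> I"
proof -
  let ?xs = "x # y # replicate (m - 2) zero"
  have "?xs \<in> nlists m A"
    using assms hyperideal_subset zero_closed by (intro hadd_list_in_nlists) auto
  \<comment> \<open>Reversibility turns the padding into \<open>neg zero\<close>, which lies in
    \<open>I\<close> by closure under \<open>neg\<close>.\<close>
  from f_reversible[OF this, of w 1]
  have "y \<in> f (w # neg x # replicate (m - 2) (neg zero))"
    using assms(5) m_ge_2 by (simp add: hadd_def)
  moreover have "f (w # neg x # replicate (m - 2) (neg zero)) \<subseteq> I"
    using assms hyperideal_zero[OF I] hyperideal_neg[OF I]
    by (intro hyperideal_f[OF I] hadd_list_in_nlists) simp_all
  ultimately show ?thesis
    by blast
qed

lemma hyperideal_hadd_cancel_right:
  assumes I: "hyperideal m n A f g I" and "x \<in> A" "y \<in> I" "w \<in> I" "w \<in> hadd x y"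
  shows "x \<in> I"
proof -
  have "hadd x y = hadd y x"
    unfolding hadd_def
    using assms hyperideal_subset zero_closed by (intro f_perm hadd_list_in_nlists) auto
  then show ?thesis
    using hyperideal_hadd_cancel_left[OF I, of y x w] assms by simp
qed

section \<open>Prime hyperideals and prime avoidance\<close>

lemma prime_hyperideal_hyperideal: "prime_hyperideal m n A f g Q \<Longrightarrow> hyperideal m n A f g Q"
  unfolding prime_hyperideal_def proper_hyperideal_def by simp

lemma one_notin_prime: "prime_hyperideal m n A f g Q \<Longrightarrow> e \<notin> Q"
  using one_notin_proper unfolding prime_hyperideal_def by simp

text \<open>Primeness puts some entry of the padded list into \<open>Q\<close>, and properness rules
  out the padding \<open>e\<close>.\<close>

lemma prime_hyperideal_mul:
  assumes "prime_hyperideal m n A f g Q" "x \<in> A" "y \<in> A" "mul x y \<in> Q"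
  shows "x \<in> Q \<or> y \<in> Q"
proof -
  let ?xs = "x # y # replicate (n - 2) e"
  obtain i where i: "i < n" "?xs ! i \<in> Q"
    using assms mul_list_in_nlists[OF assms(2,3)]
    unfolding prime_hyperideal_def mul_def by auto
  have "length ?xs = n"
    using n_ge_2 by simp
  then have "?xs ! i \<in> set ?xs"
    using i(1) by (metis nth_mem)
  then have "?xs ! i \<in> {x, y, e}"
    by (auto simp: set_replicate_conv_if split: if_splits)
  then show ?thesis
    using i(2) one_notin_prime[OF assms(1)] by auto
qed

text \<open>The witness is a product of elements picked from each \<open>R\<close> outside
  \<open>Q\<close>, starting from \<open>e\<close>; primeness keeps the product outside
  \<open>Q\<close>.\<close>

lemma ex_in_Inter_notin_prime:
  assumes "finite F" "prime_hyperideal m n A f g Q"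
    and "\<And>R. R \<in> F \<Longrightarrow> hyperideal m n A f g R \<and> \<not> R \<subseteq> Q"
  shows "\<exists>z\<in>A. z \<notin> Q \<and> z \<in> \<Inter>F"
  using assms(1,3)
proof (induction F rule: finite_induct)
  case empty
  then show ?case
    using one_closed one_notin_prime[OF assms(2)] by auto
next
  case (insert R F)
  obtain z where z: "z \<in> A" "z \<notin> Q" "z \<in> \<Inter>F"
    using insert.IH insert.prems by auto
  have R: "hyperideal m n A f g R"
    using insert.prems by simp
  obtain r where r: "r \<in> R" "r \<notin> Q"
    using insert.prems by blast
  have rA: "r \<in> A"
    using r(1) hyperideal_subset[OF R] by blast
  have "mul r z \<notin> Q"
    using prime_hyperideal_mul[OF assms(2) rA z(1)] r(2) z(2) by blast
  moreover have "mul r z \<in> R"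
    using hyperideal_mul_right[OF R r(1) z(1)] .
  moreover have "mul r z \<in> T" if "T \<in> F" for T
    using hyperideal_mul_left[OF _ rA, of T z] insert.prems z(3) that by auto
  ultimately show ?case
    using mul_closed[OF rA z(1)] by auto
qed

lemma prime_avoidance:
  assumes "finite F" and I: "hyperideal m n A f g I"
    and "\<And>Q. Q \<in> F \<Longrightarrow> prime_hyperideal m n A f g Q"
    and "\<And>Q. Q \<in> F \<Longrightarrow> \<not> I \<subseteq> Q"
  shows "\<not> I \<subseteq> \<Union>F"
  using assms(1,3,4)
proof (induction F rule: finite_psubset_induct)
  case (psubset F)
  have IH: "\<not> I \<subseteq> \<Union>(F - {Q})" if "Q \<in> F" for Q
    using psubset.IH[of "F - {Q}"] psubset.prems that by blast
  consider "F = {}" | Q Q' where "Q \<in> F" "Q' \<in> F" "Q \<subset> Q'"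
    | Q where "Q \<in> F" "\<And>R. R \<in> F - {Q} \<Longrightarrow> \<not> R \<subseteq> Q"
    by blast
  then show ?case
  proof cases
    case 1
    then show ?thesis
      using hyperideal_zero[OF I] by auto
  next
    case (2 Q Q')
    then have "\<Union>F = \<Union>(F - {Q})"
      by blast
    then show ?thesis
      using IH[OF 2(1)] by simp
  next
    case (3 Q)
    have Q: "prime_hyperideal m n A f g Q"
      using psubset.prems 3(1) by simp
    obtain x where x: "x \<in> I" "\<And>R. R \<in> F - {Q} \<Longrightarrow> x \<notin> R"
      using IH[OF 3(1)] by blast
    have xA: "x \<in> A"
      using x(1) hyperideal_subset[OF I] by blast
    show ?thesis
    proof (cases "x \<in> Q")
      case False
      then show ?thesis
        using x by blast
    next
      case True
      \<comment> \<open>Here \<open>x\<close> lies in \<open>Q\<close> but in no other member of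
        \<open>F\<close>, while \<open>z\<close> lies in all the others but not in \<open>Q\<close>.
        Each member thus contains exactly one of the two, so cancellation keeps every
        \<open>w \<in> hadd x z\<close> out of all of them.\<close>
      obtain z where z: "z \<in> A" "z \<notin> Q" "z \<in> \<Inter>(insert I (F - {Q}))"
        using ex_in_Inter_notin_prime[OF _ Q, of "insert I (F - {Q})"] psubset 3 I
          prime_hyperideal_hyperideal
        by (metis (no_types, lifting) DiffD1 finite_Diff finite_insert insert_iff)
      obtain w where w: "w \<in> hadd x z"
        using hadd_nonempty[OF xA z(1)] by blast
      have "w \<in> I"
        using hyperideal_hadd[OF I x(1)] z(3) w by blast
      moreover have "w \<notin> Q"
        using hyperideal_hadd_cancel_left[OF prime_hyperideal_hyperideal[OF Q] True z(1) _ w] z(2)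
        by blast
      moreover have "w \<notin> R" if R: "R \<in> F - {Q}" for R
        using hyperideal_hadd_cancel_right[OF prime_hyperideal_hyperideal xA _ _ w, of R]
          psubset.prems R x(2)[OF R] z(3)
        by blast
      ultimately show ?thesis
        by blast
    qed
  qed
qed

section \<open>Residuals, cancellation and the intersection formula\<close>

lemma hyperideal_residual:
  assumes P: "hyperideal m n A f g P" and x: "x \<in> A"
  shows "hyperideal m n A f g {y \<in> A. mul y x \<in> P}" (is "hyperideal _ _ _ _ _ ?I")
  unfolding hyperideal_def
proof (intro conjI ballI allI impI)
  show "?I \<noteq> {}"
    using zero_closed mul_zero_left[OF x] hyperideal_zero[OF P] by auto
  show "?I \<subseteq> A"
    by blast
  show "f ps \<subseteq> ?I" if ps: "ps \<in> nlists m ?I" for ps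
  proof -
    have psA: "ps \<in> nlists m A"
      using ps nlists_mono[of ?I A m] by blast
    have "map (\<lambda>q. mul q x) ps \<in> nlists m P"
      using nlistsE_length[OF ps] nlistsE_set[OF ps] by (intro nlistsI) auto
    then have "(\<lambda>q. mul q x) ` f ps \<subseteq> P"
      using mul_image_f[OF x psA] hyperideal_f[OF P] by simp
    then show ?thesis
      using f_closed[OF psA] by blast
  qed
  show "neg p \<in> ?I" if "p \<in> ?I" for p
    using that neg_closed mul_neg_left[OF x] hyperideal_neg[OF P] by simp
  show "g (xs[i := p]) \<in> ?I" if xs: "xs \<in> nlists n A" and i: "i < n" and p: "p \<in> ?I" for xs i p
  proof -
    \<comment> \<open>With the other entries collected in \<open>ys\<close>, symmetry of
      \<open>g\<close> moves \<open>p\<close> to the last slot, where \<open>mul_g_snoc\<close>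
      attaches \<open>x\<close> to it.\<close>
    define ys where "ys = take i xs @ drop (Suc i) xs"
    have len: "length xs = n" and set: "set xs \<subseteq> A"
      using xs by simp_all
    have ys: "ys \<in> nlists (n - 1) A"
      using len set i set_take_subset[of i xs] set_drop_subset[of "Suc i" xs]
      by (intro nlistsI) (auto simp: ys_def)
    have snoc: "ys @ [q] \<in> nlists n A" if "q \<in> A" for q
      using ys that n_ge_2 nlistsE_set[OF ys] by (intro nlistsI) auto
    have upd: "xs[i := p] \<in> nlists n A"
      using xs p by simp
    have "g (xs[i := p]) = g (ys @ [p])"
      using p i len by (intro g_perm upd snoc) (simp_all add: ys_def upd_conv_take_nth_drop)
    then have "mul (g (xs[i := p])) x = g (ys @ [mul p x])"
      using mul_g_snoc[OF ys _ x] p by simp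
    \<comment> \<open>Written as a list update, with \<open>e\<close> as placeholder, to match the
      absorption law of \<open>P\<close>.\<close>
    also have "\<dots> = g ((ys @ [e])[n - 1 := mul p x])"
      using ys by (simp add: list_update_append)
    also have "\<dots> \<in> P"
      using hyperideal_g[OF P snoc[OF one_closed], of "n - 1" "mul p x"] p n_ge_2 by simp
    finally show ?thesis
      using g_closed[OF upd] by simp
  qed
qed

text \<open>The defining condition replaces the factor \<open>s\<close> by \<open>e\<close>, leaving
  \<open>mul e x = x\<close>.\<close>

lemma S_hyperideal_mul_cancel:
  assumes "S_hyperideal m n A f g e S P" "s \<in> S" "s \<in> A" "x \<in> A" "mul s x \<in> P"
  shows "x \<in> P"
proof -
  let ?xs = "s # x # replicate (n - 2) e"
  have "g (?xs[0 := e]) \<in> P"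
    using assms mul_list_in_nlists[OF assms(3,4)] n_ge_2
    unfolding S_hyperideal_def mul_def by (metis less_le_trans nth_Cons_0 pos2)
  then show ?thesis
    using mul_one_left[OF assms(4)] by (simp add: mul_def)
qed

lemma S_hyperideal_eq_Inter:
  assumes "finite J" "J \<noteq> {}"
    and Q: "\<And>j. j \<in> J \<Longrightarrow> prime_hyperideal m n A f g (Q j)"
    and P: "S_hyperideal m n A f g e (A - (\<Union>j\<in>J. Q j)) P"
  shows "P = (\<Inter>j\<in>J. {x \<in> A. \<exists>t \<in> A - Q j. mul t x \<in> P})"
proof (intro equalityI subsetI INT_I)
  have hP: "hyperideal m n A f g P"
    using P unfolding S_hyperideal_def proper_hyperideal_def by simp
  show "x \<in> {x \<in> A. \<exists>t \<in> A - Q j. mul t x \<in> P}" if x: "x \<in> P" and j: "j \<in> J" for x j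
  proof -
    have "x \<in> A"
      using x hyperideal_subset[OF hP] by blast
    then show ?thesis
      \<comment> \<open>The witness \<open>t = e\<close> works for every \<open>j\<close>, since
        \<open>e\<close> lies in no prime.\<close>
      using mul_one_left[of x] x one_closed one_notin_prime[OF Q[OF j]] by (auto intro!: bexI[of _ e])
  qed
  show "x \<in> P" if x: "x \<in> (\<Inter>j\<in>J. {x \<in> A. \<exists>t \<in> A - Q j. mul t x \<in> P})" for x
  proof -
    have xA: "x \<in> A"
      using x assms(2) by blast
    let ?I = "{y \<in> A. mul y x \<in> P}"
    \<comment> \<open>For each \<open>j\<close>, the given \<open>t\<close> with
      \<open>mul t x \<in> P\<close> lies in \<open>?I\<close> but not in
      \<open>Q j\<close>.\<close>
    have "\<not> ?I \<subseteq> \<Union>(Q ` J)"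
    proof (rule prime_avoidance)
      show "hyperideal m n A f g ?I"
        using hyperideal_residual[OF hP xA] .
    qed (use assms(1) Q x in blast)+
    then show ?thesis
      using S_hyperideal_mul_cancel[OF P _ _ xA] by blast
  qed
qed

end

theorem theorem3p12:
  fixes m n k :: nat and A :: "'a set" and f :: "'a list \<Rightarrow> 'a set"
    and g :: "'a list \<Rightarrow> 'a" and e :: 'a and Q :: "nat \<Rightarrow> 'a set" and P :: "'a set"
  assumes "comm_krasner_hyperring m n A f g e"
    and "k \<ge> 1"
    and "\<And>j. j \<in> {1..k} \<Longrightarrow> minimal_prime_hyperideal m n A f g (Q j)"
    and "S_hyperideal m n A f g e (A - (\<Union>j\<in>{1..k}. Q j)) P"
  shows "P = (\<Inter>j\<in>{1..k}. {x \<in> A. \<exists>t \<in> A - Q j. g (t # x # replicate (n - 2) e) \<in> P})"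
proof -
  interpret comm_krasner_hyperring m n A f g e
    by (rule assms(1))
  have "prime_hyperideal m n A f g (Q j)" if "j \<in> {1..k}" for j
    using assms(3)[OF that] unfolding minimal_prime_hyperideal_def by simp
  from S_hyperideal_eq_Inter[OF _ _ this assms(4)] assms(2) show ?thesis
    unfolding mul_def by simp
qed

end
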